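(* Let $n,m$ be relatively prime positive integers with $n\mid(m-1)^2$, and let $k\ge 4$ be an integer. Then there is no $k$-stair packing polynomial on $S(n/m)$.
   Context: $\mathbb{N}=\{0,1,2,\dots\}$. For real $\alpha\ge 0$, $S(\alpha)=\{(x,y)\in\mathbb{R}^2 : x,y\ge 0,\ y\le \alpha x\}$ and $I(\alpha)=S(\alpha)\cap\mathbb{Z}^2$. A real polynomial $p(x,y)$ is a packing polynomial on $S(\alpha)$ if $p|_{I(\alpha)}$ is a bijection from $I(\alpha)$ to $\mathbb{N}$. For coprime positive integers $n,m$ and $l=\gcd(n,m-1)$, the $c$-th staircase ($c\in\mathbb{N}$) of $I(n/m)$ is the segment of points $(x,y)\in S(n/m)$ with $nx-(m-1)y=cl$ (for $m\ne 1$: $y=\frac{n}{m-1}x-c\frac{l}{m-1}$). A stair is a point with integer coordinates on a staircase. Two distinct stairs $r,s$ are consecutive if they lie on the same staircase and there is no other stair on the segment from $r$ to $s$. For $k\in\mathbb{N}$, a quadratic polynomial $p$ with homogeneous quadratic part $\frac n2\left(x-\frac{m-1}{n}y\right)^2$ and $p(\mathbb{Z}^2)\subseteq\mathbb{Z}$ is a $k$-stair polynomial on $S(n/m)$ if $p(r)-p(s)=\pm k$ for any two consecutive stairs $r,s$. A $k$-stair packing polynomial is a $k$-stair polynomial that is also a packing polynomial on $S(n/m)$. *)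

theory Defs
  imports "HOL-Analysis.Analysis" "HOL-Computational_Algebra.Polynomial"
begin

definition sector :: "real \<Rightarrow> (real \<times> real) set" where
  "sector \<alpha> = {(x, y). x \<ge> 0 \<and> y \<ge> 0 \<and> y \<le> \<alpha> * x}"

definition int_plane :: "(real \<times> real) set" where
  "int_plane = \<int> \<times> \<int>"

definition lattice_sector :: "real \<Rightarrow> (real \<times> real) set" where
  "lattice_sector \<alpha> = sector \<alpha> \<inter> int_plane"

(* A real polynomial p(x,y) is an element of R[x][y]: the outer variable is y and
   the coefficient of x^i y^j is coeff (coeff p j) i. *)
type_synonym bipoly = "real poly poly"

definition bicoeff :: "bipoly \<Rightarrow> nat \<Rightarrow> nat \<Rightarrow> real" where
  "bicoeff p i j = coeff (coeff p j) i"

definition bieval :: "bipoly \<Rightarrow> real \<times> real \<Rightarrow> real" where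
  "bieval p = (\<lambda>(x, y). poly (poly p [:y:]) x)"

definition const2 :: "real \<Rightarrow> bipoly" where "const2 a = [:[:a:]:]"
definition X2 :: bipoly where "X2 = [:[:0, 1:]:]"
definition Y2 :: bipoly where "Y2 = [:0, 1:]"

definition homogeneous_part :: "nat \<Rightarrow> bipoly \<Rightarrow> bipoly" where
  "homogeneous_part d p = (\<Sum>j\<le>d. const2 (bicoeff p (d - j) j) * X2 ^ (d - j) * Y2 ^ j)"

(* total degree exactly 2 *)
definition quadratic :: "bipoly \<Rightarrow> bool" where
  "quadratic p \<longleftrightarrow> (\<forall>i j. bicoeff p i j \<noteq> 0 \<longrightarrow> i + j \<le> 2) \<and> (\<exists>i j. i + j = 2 \<and> bicoeff p i j \<noteq> 0)"

definition packing_polynomial :: "real \<Rightarrow> bipoly \<Rightarrow> bool" where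
  "packing_polynomial \<alpha> p \<longleftrightarrow> bij_betw (bieval p) (lattice_sector \<alpha>) \<nat>"

(* With n, m positive, "m - 1" on nat is exact; for m = 1 the gcd below is gcd n 0 = n,
   and the staircases are the vertical segments x = c. *)
definition staircase :: "nat \<Rightarrow> nat \<Rightarrow> nat \<Rightarrow> (real \<times> real) set" where
  "staircase n m c = {(x, y) \<in> sector (real n / real m).
     real n * x - (real m - 1) * y = real c * real (gcd n (m - 1))}"

definition stairs :: "nat \<Rightarrow> nat \<Rightarrow> (real \<times> real) set" where
  "stairs n m = (\<Union>c. staircase n m c) \<inter> int_plane"

definition consecutive_stairs :: "nat \<Rightarrow> nat \<Rightarrow> real \<times> real \<Rightarrow> real \<times> real \<Rightarrow> bool" where
  "consecutive_stairs n m r s \<longleftrightarrow>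
     r \<in> stairs n m \<and> s \<in> stairs n m \<and> r \<noteq> s \<and>
     (\<exists>c. r \<in> staircase n m c \<and> s \<in> staircase n m c) \<and>
     stairs n m \<inter> closed_segment r s = {r, s}"

definition k_stair_polynomial :: "nat \<Rightarrow> nat \<Rightarrow> nat \<Rightarrow> bipoly \<Rightarrow> bool" where
  "k_stair_polynomial k n m p \<longleftrightarrow>
     quadratic p \<and>
     homogeneous_part 2 p =
       const2 (real n / 2) * (X2 - const2 ((real m - 1) / real n) * Y2) ^ 2 \<and>
     bieval p ` int_plane \<subseteq> \<int> \<and>
     (\<forall>r s. consecutive_stairs n m r s \<longrightarrow>
        bieval p r - bieval p s = real k \<or> bieval p r - bieval p s = - real k)"

definition k_stair_packing_polynomial :: "nat \<Rightarrow> nat \<Rightarrow> nat \<Rightarrow> bipoly \<Rightarrow> bool" where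
  "k_stair_packing_polynomial k n m p \<longleftrightarrow>
     k_stair_polynomial k n m p \<and> packing_polynomial (real n / real m) p"

lemma bieval_simps [simp]:
  "bieval (const2 a) z = a"
  "bieval X2 z = fst z"
  "bieval Y2 z = snd z"
  "bieval (p + q) z = bieval p z + bieval q z"
  "bieval (p - q) z = bieval p z - bieval q z"
  "bieval (p * q) z = bieval p z * bieval q z"
  "bieval (p ^ d) z = bieval p z ^ d"
  by (simp_all add: bieval_def const2_def X2_def Y2_def split: prod.split)

end

theory Submission
  imports Defs "HOL-Number_Theory.Cong"
begin

text \<open>
  Write \<open>l = gcd n (m - 1)\<close>, \<open>n = l N\<close>, \<open>m - 1 = l q\<close>; the divisibility hypothesis says \<open>l = t N\<close>.
  In the coordinates \<open>c = N x - q y\<close> and \<open>y\<close> a stair polynomial becomes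
  \<open>t c^2 / 2 + A c + e \<plusminus> k y / N\<close>, so on the \<open>c\<close>-th staircase its values form an arithmetic
  progression with difference \<open>k\<close>, and a packing polynomial tiles the naturals by these progressions.
  The progression of staircase \<open>c\<close> must be continued by that of another staircase, which by growth is
  \<open>c + k\<close> once \<open>c\<close> is large; this forces \<open>A = 1 / N - t k / 2\<close>, and then the first \<open>k\<close> staircases
  start at the values \<open>0, ..., k - 1\<close> in some order. These values are
  \<open>e - t c (k - c) / 2 + (v c mod k)\<close>; summing them gives \<open>12 e = t (k^2 - 1)\<close>, so \<open>e < k\<close> leaves
  only finitely many pairs \<open>(t, k)\<close>.
\<close>

section \<open>Tilings of the naturals by finite arithmetic progressions with difference
  \<open>k\<close>\<close>

text \<open>Two residues add up to at most \<open>2 * N - 2\<close>, so a sum that wraps around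
  cannot reach \<open>N - 1\<close>.\<close>

lemma add_mod_eq_pred:
  fixes x y N :: nat
  assumes "(x + y) mod N = N - 1" "x < N" "y < N"
  shows "x + y = N - 1"
proof (cases "x + y < N")
  case False
  then have "(x + y) mod N = x + y - N" using assms by (simp add: le_mod_geq)
  then show ?thesis using assms False by linarith
qed (use assms in simp)

text \<open>
  The \<open>c\<close>-th staircase has \<open>L c\<close> stairs, the lowest at height \<open>u * c mod N\<close>, where \<open>f c\<close> is taken.
\<close>

locale stair_tiling =
  fixes f L :: "nat \<Rightarrow> nat" and t N k u :: nat and A e :: real
  assumes t_pos: "0 < t" and N_pos: "0 < N" and k_ge4: "4 \<le> k" and cop: "coprime u N"
    and L_eq: "\<And>c. L c = c * t + (if N dvd c then 1 else 0)"
    and f_eq: "\<And>c. real (f c) = real t * (real c)\<^sup>2 / 2 + A * real c + e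
                 + real k * real (u * c mod N) / real N"
    and bij: "bij_betw (\<lambda>(c, j). f c + k * j) (SIGMA c:UNIV. {..<L c}) UNIV"
begin

lemma L_pos: "0 < L c"
  using t_pos by (cases "c = 0") (auto simp: L_eq)

lemma tile_ex: "\<exists>c j. j < L c \<and> f c + k * j = z"
proof -
  have "z \<in> (\<lambda>(c, j). f c + k * j) ` (SIGMA c:UNIV. {..<L c})"
    using bij by (simp add: bij_betw_def)
  then show ?thesis by auto
qed

lemma tile_unique:
  assumes "f c + k * j = f c' + k * j'" "j < L c" "j' < L c'"
  shows "c = c' \<and> j = j'"
proof -
  have "inj_on (\<lambda>(c, j). f c + k * j) (SIGMA c:UNIV. {..<L c})"
    using bij by (simp add: bij_betw_def)
  from inj_onD[OF this, of "(c, j)" "(c', j')"] assms show ?thesis by auto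
qed

lemma f_inj: "f c = f c' \<Longrightarrow> c = c'"
  using tile_unique[of c 0 c' 0] L_pos by auto

lemma next_tile: "\<exists>c'. f c' = f c + k * L c"
proof -
  obtain c' j where j: "j < L c'" "f c' + k * j = f c + k * L c"
    using tile_ex by blast
  have "j = 0"
  proof (rule ccontr)
    assume "j \<noteq> 0"
    \<comment> \<open>otherwise the predecessor of the value in both progressions would be taken twice\<close>
    then obtain i where i: "j = Suc i" by (cases j) auto
    obtain l where l: "L c = Suc l" using L_pos[of c] by (cases "L c") auto
    have "f c' + k * i = f c + k * l" using j i l by simp
    then have "c' = c \<and> i = l" by (rule tile_unique) (use i j l in auto)
    then show False using i l j by simp
  qed
  then show ?thesis using j by auto
qed

section \<open>Growth: the progression of a late staircase is continued by staircase
  \<open>c + k\<close>\<close>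

text \<open>\<open>f c\<close> differs from \<open>phi c + e\<close> only by the residue term, which
  lies between 0 and \<open>k\<close>. Values of \<open>f\<close> can thus be compared through this
  parabola up to a bounded error.\<close>

definition phi :: "real \<Rightarrow> real" where "phi x = real t * x\<^sup>2 / 2 + A * x"

lemma phi_diff: "phi b - phi a = (b - a) * (real t * (a + b) / 2 + A)"
  unfolding phi_def by (simp add: field_simps power2_eq_square)

lemma phi_mono:
  assumes "0 \<le> a" "a \<le> b" "0 \<le> real t * b / 2 + A"
  shows "phi a \<le> phi b"
proof -
  have "0 \<le> real t * a" using assms by simp
  then have "0 \<le> real t * (a + b) / 2 + A" using assms by (simp add: field_simps)
  then have "0 \<le> (b - a) * (real t * (a + b) / 2 + A)" using assms by simp
  then show ?thesis using phi_diff[of b a] by linarith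
qed

text \<open>The successor \<open>c'\<close> satisfies \<open>phi c' = phi c + k * c * t\<close> up
  to a bounded error, while \<open>phi\<close> at \<open>c + k + 1\<close> and at
  \<open>c + k - 1\<close> misses this value by about \<open>t * c\<close> from above and below. For
  large \<open>c\<close> only \<open>c' = c + k\<close> is left.\<close>

lemma next_tile_eq:
  "\<exists>C. \<forall>c\<ge>C. f (c + k) = f c + k * L c"
proof -
  \<comment> \<open>\<open>M\<close> exceeds the error \<open>2 * k\<close> plus the part of either
    increment of \<open>phi\<close> that does not grow with \<open>c\<close>. It is also at least
    \<open>2 * \<bar>A\<bar>\<close>, so that \<open>phi_mono\<close> applies beyond
    \<open>c\<close>.\<close>
  define M :: real where "M = 2 * real k + (real k + 1) * (real t * (real k + 1) + 2 * \<bar>A\<bar>) + 2 * \<bar>A\<bar>"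
  have large: "f (c + k) = f c + k * L c" if c: "M < real c" for c
  proof -
    have tr: "1 \<le> real t" and kr: "4 \<le> real k" using t_pos k_ge4 by auto
    have ctc: "real c \<le> real t * real c"
      using tr mult_right_mono[of 1 "real t" "real c"] by simp
    have M2: "2 * real k + 2 * \<bar>A\<bar> \<le> M" and M1: "0 \<le> M"
      unfolding M_def using tr kr by auto
    obtain c' where c': "f c' = f c + k * L c" using next_tile by blast
    have yb: "0 \<le> real k * real (u * x mod N) / real N \<and> real k * real (u * x mod N) / real N \<le> real k" for x
      using N_pos by (simp add: divide_le_eq mult_left_mono less_imp_le)
    have Lr: "real k * real (L c) = real k * real c * real t + real k * (if N dvd c then 1 else 0)"
      by (simp add: L_eq algebra_simps)
    have "real (f c') = real (f c) + real k * real (L c)" using c' by simp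
    \<comment> \<open>The two residue terms and the extra stair when \<open>N dvd c\<close> each
      contribute between 0 and \<open>k\<close>; the residue terms enter with opposite
      signs.\<close>
    then have d: "\<bar>phi (real c') - phi (real c) - real k * real c * real t\<bar> \<le> 2 * real k"
      using yb[of c'] yb[of c] kr unfolding f_eq Lr phi_def abs_le_iff
      by (cases "N dvd c"; simp only: if_True if_False; argo)
    have hi: "c' \<le> c + k"
    proof (rule ccontr)
      assume "\<not> c' \<le> c + k"
      then have "real c + real k + 1 \<le> real c'" by linarith
      moreover have "0 \<le> real t * real c' / 2 + A"
      proof -
        have "real c' \<le> real t * real c'"
          using tr mult_right_mono[of 1 "real t" "real c'"] by simp
        then show ?thesis using \<open>real c + real k + 1 \<le> real c'\<close> c M2 kr by linarith
      qed
      ultimately have "phi (real c + real k + 1) \<le> phi (real c')"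
        using kr by (intro phi_mono) auto
      moreover have "phi (real c + real k + 1) - phi (real c)
          = real k * real c * real t + real t * real c + (real k + 1) * (real t * (real k + 1) / 2 + A)"
        unfolding phi_diff by (simp add: field_simps)
      moreover have "(real k + 1) * (real t * (real k + 1) / 2 + A) \<ge> - ((real k + 1) * (real t * (real k + 1) + 2 * \<bar>A\<bar>))"
      proof -
        have "- (real t * (real k + 1) + 2 * \<bar>A\<bar>) \<le> real t * (real k + 1) / 2 + A"
        proof -
          have "0 \<le> real t * (real k + 1)" by simp
          then show ?thesis by linarith
        qed
        then have "(real k + 1) * - (real t * (real k + 1) + 2 * \<bar>A\<bar>) \<le> (real k + 1) * (real t * (real k + 1) / 2 + A)"
          by (intro mult_left_mono) auto
        then show ?thesis by (simp only: mult_minus_right)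
      qed
      ultimately show False using d ctc c unfolding M_def by linarith
    qed
    have lo: "c + k \<le> c'"
    proof (rule ccontr)
      assume "\<not> c + k \<le> c'"
      then have le: "real c' \<le> real c + real k - 1" by linarith
      moreover have "0 \<le> real t * (real c + real k - 1) / 2 + A"
      proof -
        have "real c + real k - 1 \<le> real t * (real c + real k - 1)"
          using tr kr mult_right_mono[of 1 "real t" "real c + real k - 1"] by simp
        then show ?thesis using c M2 kr by linarith
      qed
      ultimately have "phi (real c') \<le> phi (real c + real k - 1)"
        by (intro phi_mono) auto
      moreover have "phi (real c + real k - 1) - phi (real c)
          = real k * real c * real t - real t * real c + (real k - 1) * (real t * (real k - 1) / 2 + A)"
        unfolding phi_diff by (simp add: field_simps)
      moreover have "(real k - 1) * (real t * (real k - 1) / 2 + A) \<le> (real k + 1) * (real t * (real k + 1) + 2 * \<bar>A\<bar>)"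
      proof -
        have "real t * (real k - 1) / 2 \<le> real t * (real k + 1)"
          using mult_left_mono[of "(real k - 1) / 2" "real k + 1" "real t"] kr tr by simp
        then have "real t * (real k - 1) / 2 + A \<le> real t * (real k + 1) + 2 * \<bar>A\<bar>" by linarith
        then have "(real k - 1) * (real t * (real k - 1) / 2 + A) \<le> (real k - 1) * (real t * (real k + 1) + 2 * \<bar>A\<bar>)"
          using kr by (intro mult_left_mono) auto
        also have "\<dots> \<le> (real k + 1) * (real t * (real k + 1) + 2 * \<bar>A\<bar>)"
          by (intro mult_right_mono) auto
        finally show ?thesis .
      qed
      ultimately show False using d ctc c unfolding M_def by linarith
    qed
    show ?thesis using hi lo c' by simp
  qed
  have "M < real c" if "nat \<lceil>M\<rceil> + 1 \<le> c" for c
    using that by linarith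
  then show ?thesis using large by blast
qed

section \<open>The linear coefficient and the exact shift by \<open>k\<close>\<close>

text \<open>All terms growing with \<open>c\<close> cancel, so the right-hand side depends on
  \<open>c\<close> only through its residue modulo \<open>N\<close>.\<close>

lemma f_shift:
  "real (f (c + k)) - real (f c) - real k * real (L c)
    = real k * (real t * real k / 2 + A + real (u * (c + k) mod N) / real N
        - real (u * c mod N) / real N - (if N dvd c then 1 else 0))"
  using N_pos by (simp add: f_eq L_eq field_simps power2_eq_square)

lemma slope_eq:
  assumes "f (c + k) = f c + k * L c"
  shows "A = (if N dvd c then 1 else 0) - real t * real k / 2
    + (real (u * c mod N) - real (u * (c + k) mod N)) / real N"
proof -
  have "real (f (c + k)) - real (f c) - real k * real (L c) = 0" using assms by simp
  then show ?thesis unfolding f_shift using k_ge4 by (simp add: diff_divide_distrib)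
qed

text \<open>The shift identity is evaluated at two large arguments, one divisible by
  \<open>N\<close> and one with \<open>u * c\<close> congruent to 1. Both express \<open>A\<close>
  through \<open>w\<close>, and equating them forces \<open>w = N - 1\<close>.\<close>

lemma residue_and_slope:
  "u * k mod N = N - 1" "A = 1 / real N - real t * real k / 2"
proof -
  obtain C where C: "\<And>c. C \<le> c \<Longrightarrow> f (c + k) = f c + k * L c"
    using next_tile_eq by blast
  define w where "w = u * k mod N"
  have w: "w < N" using N_pos by (simp add: w_def)
  have "C \<le> N * C" using N_pos by simp
  moreover have "u * (N * C + k) mod N = w"
    unfolding w_def by (simp add: distrib_left mult.left_commute)
  ultimately have A1: "A = 1 - real t * real k / 2 - real w / real N"
    using slope_eq[OF C, of "N * C"] by (simp add: mult.left_commute)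
  have "w = N - 1"
  proof (cases "N = 1")
    case False
    then have N2: "1 < N" using N_pos by simp
    obtain v where v: "[u * v = 1] (mod N)" using cop cong_solve_coprime_nat by auto
    define c where "c = v + N * C"
    have "C \<le> c" using N_pos by (simp add: c_def trans_le_add2)
    have uc: "u * c mod N = 1"
      using v N2 unfolding c_def cong_def by (simp add: distrib_left mult.left_commute)
    have nd: "\<not> N dvd c"
    proof
      assume "N dvd c"
      then have "u * c mod N = 0" by simp
      then show False using uc by simp
    qed
    have "u * (c + k) mod N = (1 + w) mod N"
      using uc unfolding w_def by (metis distrib_left mod_add_eq mod_mod_trivial)
    then have A2: "A = - real t * real k / 2 + (1 - real ((1 + w) mod N)) / real N"
      using slope_eq[OF C[OF \<open>C \<le> c\<close>]] nd uc by simp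
    have "1 - real w / real N = (1 - real ((1 + w) mod N)) / real N" using A1 A2 by simp
    then have eq: "real N - real w = 1 - real ((1 + w) mod N)"
      using N_pos by (simp add: field_simps)
    \<comment> \<open>Without wrap-around, \<open>eq\<close> would read
      \<open>N - w = - w\<close>.\<close>
    have "\<not> 1 + w < N" using eq N_pos by auto
    then show ?thesis using w by simp
  qed (use w in simp)
  then show "u * k mod N = N - 1" by (simp add: w_def)
  show "A = 1 / real N - real t * real k / 2"
    using A1 \<open>w = N - 1\<close> N_pos by (simp add: field_simps of_nat_diff)
qed

lemma N_dvd: "N dvd u * k + 1"
proof -
  have "(u * k + 1) mod N = (N - 1 + 1) mod N"
    using residue_and_slope(1) by (metis mod_add_left_eq)
  then show ?thesis using N_pos by (simp add: dvd_eq_mod_eq_0)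
qed

lemma coprime_N_k: "coprime N k"
proof (rule coprimeI)
  fix d assume "d dvd N" "d dvd k"
  then have "d dvd u * k + 1" "d dvd u * k" using N_dvd by (auto intro: dvd_trans)
  then have "d dvd 1" using dvd_add_right_iff by blast
  then show "is_unit d" .
qed

lemma N_dvd_iff: "N dvd c \<longleftrightarrow> u * c mod N = 0"
  using cop by (metis coprime_commute coprime_dvd_mult_right_iff dvd_eq_mod_eq_0)

text \<open>Adding \<open>k\<close> lowers the residue \<open>y\<close> cyclically by 1. With the
  value of \<open>A\<close> just found, the wrap-around at \<open>y = 0\<close> compensates exactly
  for the extra stair, so the identity holds for every \<open>c\<close> and not only
  eventually.\<close>

lemma f_add_k: "f (c + k) = f c + k * L c"
proof -
  define y where "y = u * c mod N"
  have y: "y < N" using N_pos by (simp add: y_def)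
  have "u * (c + k) mod N = (y + (N - 1)) mod N"
    unfolding y_def residue_and_slope(1)[symmetric] by (simp add: distrib_left mod_add_eq)
  also have "\<dots> = (if y = 0 then N - 1 else y - 1)"
  proof (cases "y = 0")
    case False
    then have "y + (N - 1) = (y - 1) + N" using N_pos by simp
    then show ?thesis using False y mod_add_self2[of "y - 1" N] by (simp only: if_False mod_less)
  qed (use N_pos in simp)
  finally have y': "u * (c + k) mod N = (if y = 0 then N - 1 else y - 1)" .
  have "real (f (c + k)) - real (f c) - real k * real (L c) = 0"
    unfolding f_shift y' y_def[symmetric] N_dvd_iff residue_and_slope(2)
    using N_pos by (auto simp: field_simps of_nat_diff)
  then have "real (f (c + k)) = real (f c + k * L c)" by simp
  then show ?thesis using of_nat_eq_iff by blast
qed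

section \<open>The first \<open>k\<close> staircases and the constant term\<close>

text \<open>If \<open>f c - k\<close> were a natural number, it would lie in some progression
  \<open>c'\<close>. Its next term \<open>f c\<close> is then either a later term of
  \<open>c'\<close> or, past the end, the start \<open>f (c' + k)\<close>; uniqueness excludes the
  first and \<open>c < k\<close> the second.\<close>

lemma f_less:
  assumes "c < k"
  shows "f c < k"
proof (rule ccontr)
  assume "\<not> f c < k"
  obtain c' j where j: "j < L c'" "f c' + k * j = f c - k" using tile_ex by blast
  then have eq: "f c' + k * Suc j = f c + k * 0" using \<open>\<not> f c < k\<close> by simp
  show False
  proof (cases "Suc j < L c'")
    case True
    then show False using tile_unique[OF eq True L_pos] by simp
  next
    case False
    then have "Suc j = L c'" using j by simp
    then have "f (c' + k) = f c" using eq f_add_k by simp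
    then show False using f_inj assms by fastforce
  qed
qed

lemma f_image: "f ` {..<k} = {..<k}"
proof (rule endo_inj_surj)
  show "inj_on f {..<k}" using f_inj by (auto intro: inj_onI)
qed (use f_less in auto)

lemma e_eq: "real (f 0) = e"
  by (simp add: f_eq)

text \<open>The residues of \<open>u * c\<close> and \<open>u * (k - c)\<close> add up to
  \<open>N - 1\<close>, so the unknown residues disappear from the sum.\<close>

lemma pair_sum:
  assumes "0 < c" "c < k"
  shows "real (f c) + real (f (k - c)) = 2 * e + real k - real t * real c * (real k - real c)"
proof -
  define y where "y = u * c mod N"
  have y: "y < N" using N_pos by (simp add: y_def)
  have "(u * (k - c) mod N + y) mod N = N - 1"
    unfolding y_def using residue_and_slope(1) assms
    by (simp add: mod_add_eq flip: distrib_left)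
  moreover have "u * (k - c) mod N < N" using N_pos by simp
  ultimately have "u * (k - c) mod N + y = N - 1"
    using y add_mod_eq_pred by blast
  then have "real (u * (k - c) mod N) + real y = real N - 1"
    using N_pos by (metis of_nat_add of_nat_diff of_nat_1 Suc_leI One_nat_def)
  then have y': "real (u * (k - c) mod N) = real N - 1 - real y" by simp
  show ?thesis
    unfolding f_eq y' residue_and_slope(2) y_def[symmetric] using assms N_pos
    by (simp add: of_nat_diff field_simps power2_eq_square)
qed

text \<open>The upper limit \<open>j\<close> is kept separate from \<open>x\<close> to allow
  induction; the application has both equal to \<open>k\<close>.\<close>

lemma sum_parabola: "(\<Sum>c\<in>{1..<j}. real c * (x - real c)) = (real j - 1) * real j * (3 * x - 2 * real j + 1) / 6"
  if "0 < j"
  using that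
proof (induction j rule: nat_induct_non_zero)
  case (Suc j)
  have "{1..<Suc j} = insert j {1..<j}" using Suc by auto
  then show ?case using Suc by (simp add: field_simps)
qed simp

text \<open>By \<open>f_image\<close> the values \<open>f c\<close> for \<open>c < k\<close> permute
  \<open>0, ..., k - 1\<close>, which gives their sum. Pairing \<open>c\<close> with
  \<open>k - c\<close> gives the same sum in terms of \<open>e\<close>; the term
  \<open>c = 0\<close> is split off because its partner \<open>k\<close> is out of range.\<close>

lemma e_value: "12 * f 0 = t * (k\<^sup>2 - 1)"
proof -
  have split: "{..<k} = insert 0 {1..<k}" using k_ge4 by auto
  have "(\<Sum>c<k. f c) = \<Sum> (f ` {..<k})"
    using f_inj by (subst sum.reindex) (auto intro: inj_onI)
  then have "real (\<Sum>c<k. f c) = real (\<Sum>c<k. c)" by (simp add: f_image)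
  then have "(\<Sum>c\<in>{1..<k}. real (f c)) + e = (\<Sum>c\<in>{1..<k}. real c)"
    unfolding split by (simp add: e_eq)
  moreover have "(\<Sum>c\<in>{1..<k}. real c) = real k * (real k - 1) / 2"
  proof -
    have "(\<Sum>c\<in>{1..<j}. real c) = real j * (real j - 1) / 2" if "0 < j" for j
      using that
    proof (induction j rule: nat_induct_non_zero)
      case (Suc j)
      have "{1..<Suc j} = insert j {1..<j}" using Suc by auto
      then show ?case using Suc by (simp add: field_simps)
    qed simp
    then show ?thesis using k_ge4 by simp
  qed
  moreover have "(\<Sum>c\<in>{1..<k}. real (f (k - c))) = (\<Sum>c\<in>{1..<k}. real (f c))"
    by (rule sum.reindex_bij_witness[of _ "\<lambda>c. k - c" "\<lambda>c. k - c"]) auto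
  moreover have "(\<Sum>c\<in>{1..<k}. real (f c) + real (f (k - c)))
      = (\<Sum>c\<in>{1..<k}. 2 * e + real k - real t * (real c * (real k - real c)))"
    by (rule sum.cong) (auto simp: pair_sum mult.assoc)
  then have "(\<Sum>c\<in>{1..<k}. real (f c)) + (\<Sum>c\<in>{1..<k}. real (f (k - c)))
      = (real k - 1) * (2 * e + real k) - real t * ((real k - 1) * real k * (real k + 1) / 6)"
    using k_ge4 sum_parabola[of k "real k"]
    by (simp add: sum.distrib sum_subtractf of_nat_diff flip: sum_distrib_left)
  moreover have "S + S = R \<Longrightarrow> 2 * S = R" for S R :: real by simp
  ultimately have "2 * (real k * (real k - 1) / 2 - e)
      = (real k - 1) * (2 * e + real k) - real t * ((real k - 1) * real k * (real k + 1) / 6)"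
    by (simp only: eq_diff_eq[symmetric])
  then have "real k * (12 * e) = real k * (real t * ((real k)\<^sup>2 - 1))"
    by (simp add: field_simps power2_eq_square)
  then have "12 * e = real t * ((real k)\<^sup>2 - 1)" using k_ge4 by simp
  then have "real (12 * f 0) = real (t * (k\<^sup>2 - 1))"
    using k_ge4 by (simp add: e_eq of_nat_diff)
  then show ?thesis using of_nat_eq_iff by blast
qed

section \<open>Elimination of \<open>N\<close> and \<open>u\<close>, and the finite check\<close>

text \<open>The terms \<open>c / N\<close> and \<open>k * y c / N\<close> combine to an integer in
  \<open>{0..<k}\<close> that is congruent to \<open>c / N\<close> modulo \<open>k\<close>. So
  \<open>v\<close> is the inverse of \<open>N\<close> modulo \<open>k\<close>, and only
  \<open>t\<close>, \<open>k\<close>, \<open>v\<close> and \<open>f 0\<close> remain.\<close>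

lemma f_formula:
  obtains v where "v < k"
    "\<And>c. c < k \<Longrightarrow> 2 * int (f c) = 2 * int (f 0) + 2 * int (v * c mod k) - int t * int c * (int k - int c)"
proof -
  define y where "y c = u * c mod N" for c
  have y: "y c < N" for c using N_pos by (simp add: y_def)
  \<comment> \<open>Modulo \<open>N\<close> the number is \<open>c * (u * k + 1)\<close>.\<close>
  have dvd: "N dvd c + k * y c" for c
  proof -
    have "[c + k * y c = c + k * (u * c)] (mod N)"
      unfolding y_def cong_def by (metis mod_add_right_eq mod_mult_right_eq)
    moreover have "N dvd c + k * (u * c)"
      using dvd_mult2[OF N_dvd, of c] by (simp add: algebra_simps)
    ultimately show ?thesis using cong_dvd_iff by blast
  qed
  define g where "g c = (c + k * y c) div N" for c
  have g: "N * g c = c + k * y c" for c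
    using dvd by (simp add: g_def)
  have g_less: "g c < k" if "c < k" for c
  proof -
    have "c + k * y c < k + k * (N - 1)"
      using that y[of c] by (intro add_less_le_mono mult_left_mono) auto
    also have "\<dots> = N * k" using N_pos by (cases N) auto
    finally show ?thesis using g[of c] N_pos by (metis nat_mult_less_cancel1)
  qed
  define v where "v = g 1"
  have gv: "g c = v * c mod k" if "c < k" for c
  proof -
    have "[N * g c = c] (mod k)" using g[of c] by (simp add: cong_def)
    moreover have "[N * (v * c) = c] (mod k)"
    proof -
      have "N * (v * c) = c + k * (y 1 * c)"
        using g[of 1] by (metis (no_types, opaque_lifting) v_def mult.assoc distrib_right mult_1)
      then show ?thesis by (simp add: cong_def)
    qed
    ultimately have "[N * g c = N * (v * c)] (mod k)" using cong_sym cong_trans by blast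
    then have "[g c = v * c] (mod k)" using coprime_N_k by (simp add: cong_mult_lcancel_nat)
    then show ?thesis using g_less[OF that] by (simp add: cong_def)
  qed
  show ?thesis
  proof (rule that)
    show "v < k" using g_less[of 1] k_ge4 by (simp add: v_def)
    fix c assume "c < k"
    have "real N * real (g c) = real c + real k * real (y c)" using g[of c] by (metis of_nat_add of_nat_mult)
    then have g': "real (g c) = (real c + real k * real (y c)) / real N"
      using N_pos by (simp add: field_simps)
    have "2 * real (f c) = 2 * real (f 0) + 2 * real (g c) - real t * real c * (real k - real c)"
      unfolding e_eq g' unfolding f_eq residue_and_slope(2) y_def[symmetric] using N_pos
      by (simp add: field_simps power2_eq_square)
    then have "real_of_int (2 * int (f c))
        = real_of_int (2 * int (f 0) + 2 * int (g c) - int t * int c * (int k - int c))" by simp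
    then show "2 * int (f c) = 2 * int (f 0) + 2 * int (v * c mod k) - int t * int c * (int k - int c)"
      unfolding gv[OF \<open>c < k\<close>] using of_int_eq_iff by blast
  qed
qed

lemma no_tiling: False
proof -
  obtain v where v: "v < k"
    and F: "\<And>c. c < k \<Longrightarrow> 2 * int (f c) = 2 * int (f 0) + 2 * int (v * c mod k) - int t * int c * (int k - int c)"
    using f_formula by blast
  have e12: "12 * f 0 = t * (k\<^sup>2 - 1)" by (rule e_value)
  have "12 * f 0 \<le> 12 * (k - 1)" using f_less[of 0] k_ge4 by simp
  \<comment> \<open>The bound \<open>f 0 < k\<close> against \<open>e_value\<close>; the common
    factor \<open>k - 1\<close> cancels.\<close>
  then have "t * (k + 1) * (k - 1) \<le> 12 * (k - 1)"
    unfolding e12 using k_ge4 by (cases k) (simp_all add: power2_eq_square algebra_simps)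
  then have tk: "t * (k + 1) \<le> 12" using k_ge4 by simp
  have "t * 5 \<le> t * (k + 1)" using k_ge4 by simp
  then have "t \<le> 2" using tk by linarith
  moreover have "k \<le> 11" using tk t_pos mult_le_mono1[of 1 t "k + 1"] by simp
  moreover have "2 dvd t * (k - 1)"
  proof -
    have "int t * (int k - 1) = 2 * (int (f 0) + int (v mod k) - int (f 1))"
      using F[of 1] k_ge4 by simp
    then have "2 dvd int t * (int k - 1)" by simp
    then have "2 dvd int (t * (k - 1))" using k_ge4 by (simp add: of_nat_diff)
    then show ?thesis by presburger
  qed
  moreover have "t = 1 \<or> t = 2" using t_pos \<open>t \<le> 2\<close> by linarith
  moreover have "k \<in> {4,5,6,7,8,9,10,11}" using k_ge4 \<open>k \<le> 11\<close> by auto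
  ultimately have cases: "t = 1 \<and> k = 5 \<and> f 0 = 2 \<or> t = 1 \<and> k = 7 \<and> f 0 = 4
      \<or> t = 1 \<and> k = 11 \<and> f 0 = 10 \<or> t = 2 \<and> k = 5 \<and> f 0 = 4"
    using e12 tk by (elim disjE insertE emptyE) (simp_all, presburger+)
  have inj: "f c \<noteq> f d" if "c \<noteq> d" for c d using f_inj that by blast
  show False using cases
  proof (elim disjE conjE)
    \<comment> \<open>In both cases with \<open>k = 5\<close>, \<open>F\<close> gives
      \<open>f 1 = v\<close>; each \<open>v\<close> then leads to a negative value or to a repeated
      one.\<close>
    assume h: "t = 1" "k = 5" "f 0 = 2"
    have "v \<in> {0,1,2,3,4}" using v h by auto
    then show False
      using F[of 1] F[of 2] F[of 3] F[of 4] inj[of 0 1] inj[of 0 2] inj[of 1 2] inj[of 1 3] inj[of 0 4] h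
      by (elim insertE emptyE) simp_all
  next
    assume h: "t = 2" "k = 5" "f 0 = 4"
    have "v \<in> {0,1,2,3,4}" using v h by auto
    then show False
      using F[of 1] F[of 2] F[of 3] F[of 4] inj[of 0 1] inj[of 0 2] inj[of 1 2] inj[of 1 3] inj[of 0 4] h
      by (elim insertE emptyE) simp_all
  next
    \<comment> \<open>For \<open>v > 0\<close>, \<open>f 1 = v + 1\<close> and
      \<open>f 6 = 8 - v\<close>, hence \<open>v\<close> is from 2 to 5. The values 3 and 4 repeat
      \<open>f 0\<close>, while 2 and 5 give \<open>f 1 = f 2\<close> and \<open>f 5 = f 6\<close>.
      For \<open>v = 0\<close>, \<open>f 2\<close> would be negative.\<close>
    assume h: "t = 1" "k = 7" "f 0 = 4"
    have "v \<in> {0,1,2,3,4,5,6}" using v h by auto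
    then show False
      using F[of 1] F[of 2] F[of 5] F[of 6] inj[of 0 1] inj[of 0 6] inj[of 1 2] inj[of 5 6]
        f_less[of 1] f_less[of 6] h
      by (elim insertE emptyE) simp_all
  next
    \<comment> \<open>For \<open>v > 0\<close> the sum \<open>f 1 + f 10\<close> is 21, too large
      for two values below 11; for \<open>v = 0\<close> the two values coincide.\<close>
    assume h: "t = 1" "k = 11" "f 0 = 10"
    have "v \<in> {0,1,2,3,4,5,6,7,8,9,10}" using v h by (simp, presburger)
    then show False
      using F[of 1] F[of 10] f_less[of 1] f_less[of 10] inj[of 0 1] inj[of 0 10] inj[of 1 10] h
      by (elim insertE emptyE) simp_all
  qed
qed

end

text \<open>The lattice sector in the coordinates \<open>(N x - q y, y)\<close>.\<close>

definition skew_sector :: "nat \<Rightarrow> nat \<Rightarrow> int \<Rightarrow> (int \<times> int) set" where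
  "skew_sector N t q = {(c, y). 0 \<le> y \<and> y \<le> c * int t * int N \<and> int N dvd c + q * y}"

section \<open>From lattice points in skew coordinates to tilings\<close>

lemma coprime_if_cong_minus_1:
  assumes "[int u * q = - 1] (mod int N)"
  shows "coprime u N"
proof -
  have "coprime (int u) (int N)"
  proof (rule coprimeI)
    fix d assume d: "d dvd int u" "d dvd int N"
    have "int N dvd int u * q + 1" using assms by (simp add: cong_iff_dvd_diff)
    then have "d dvd int u * q + 1" using d dvd_trans by blast
    then have "d dvd 1" using d dvd_add_right_iff dvd_mult2 by blast
    then show "is_unit d" .
  qed
  then show ?thesis by simp
qed

text \<open>Since \<open>u\<close> is the inverse of \<open>- q\<close> modulo \<open>N\<close>, the
  divisibility condition says that \<open>y\<close> is congruent to \<open>u * c\<close>. The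
  heights over \<open>c\<close> thus rise from \<open>u * c mod N\<close> in steps of
  \<open>N\<close> up to at most \<open>c * t * N\<close>: there are \<open>c * t\<close> of them,
  plus one if the lowest is 0.\<close>

lemma bij_betw_skew_sector:
  fixes N t u :: nat and q :: int
  assumes "0 < N" "0 < t" and uq: "[int u * q = - 1] (mod int N)"
  shows "bij_betw (\<lambda>(c, j). (int c, int (u * c mod N + N * j)))
    (SIGMA c:UNIV. {..<c * t + (if N dvd c then 1 else 0)}) (skew_sector N t q)"
proof -
  have cop: "coprime (int u) (int N)" using coprime_if_cong_minus_1[OF uq] by simp
  have dvd_iff: "int N dvd c + q * y \<longleftrightarrow> [y = int u * c] (mod int N)" for c y :: int
  proof -
    have "int N dvd c + q * y \<longleftrightarrow> int N dvd int u * (c + q * y)"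
      using cop by (metis coprime_commute coprime_dvd_mult_right_iff)
    also have "int u * (c + q * y) = (int u * c - y) + (int u * q + 1) * y"
      by (simp add: algebra_simps)
    also have "int N dvd \<dots> \<longleftrightarrow> int N dvd int u * c - y"
      using uq by (simp add: cong_iff_dvd_diff dvd_add_left_iff)
    also have "\<dots> \<longleftrightarrow> [y = int u * c] (mod int N)"
      by (simp add: cong_iff_dvd_diff dvd_diff_commute)
    finally show ?thesis .
  qed
  have N_dvd_iff: "N dvd c \<longleftrightarrow> u * c mod N = 0" for c
    using cop by (metis coprime_commute coprime_dvd_mult_right_iff coprime_int_iff dvd_eq_mod_eq_0)
  have len: "u * c mod N + N * j \<le> c * t * N \<longleftrightarrow> j < c * t + (if N dvd c then 1 else 0)" for c j
  proof (cases "N dvd c")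
    case True
    then have "u * c mod N + N * j \<le> c * t * N \<longleftrightarrow> N * j \<le> N * (c * t)"
      by (simp add: N_dvd_iff mult.commute)
    then show ?thesis using True \<open>0 < N\<close> by (simp add: less_Suc_eq_le)
  next
    case False
    then have y: "0 < u * c mod N" "u * c mod N < N" using \<open>0 < N\<close> by (auto simp: N_dvd_iff)
    have "u * c mod N + N * j \<le> c * t * N \<longleftrightarrow> N * j < N * (c * t)"
    proof
      assume "N * j < N * (c * t)"
      then have "N * Suc j \<le> N * (c * t)" by (intro mult_le_mono2 Suc_leI) simp
      then show "u * c mod N + N * j \<le> c * t * N" using y by (simp add: mult.commute)
    next
      assume "u * c mod N + N * j \<le> c * t * N"
      moreover have "c * t * N = N * (c * t)" by simp
      ultimately show "N * j < N * (c * t)" using y(1) by linarith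
    qed
    then show ?thesis using False \<open>0 < N\<close> by simp
  qed
  show ?thesis
  proof (rule bij_betw_byWitness[where f' = "\<lambda>(c, y). (nat c, nat y div N)"])
    show "\<forall>a\<in>SIGMA c:UNIV. {..<c * t + (if N dvd c then 1 else 0)}.
        (case case a of (c, j) \<Rightarrow> (int c, int (u * c mod N + N * j)) of (c, y) \<Rightarrow> (nat c, nat y div N)) = a"
      using \<open>0 < N\<close> by (auto simp del: of_nat_add)
    have sk: "0 \<le> c \<and> 0 \<le> y \<and> nat y mod N = u * nat c mod N \<and> nat y \<le> nat c * t * N"
      if "(c, y) \<in> skew_sector N t q" for c y
    proof -
      have h: "0 \<le> y" "y \<le> c * int t * int N" "[y = int u * c] (mod int N)"
        using that dvd_iff by (auto simp: skew_sector_def)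
      then have "0 \<le> c * (int t * int N)" by (simp add: mult.assoc)
      moreover have "0 < int t * int N" using assms by simp
      ultimately have c: "0 \<le> c" using zero_le_mult_iff[of c "int t * int N"] by linarith
      have "[nat y = u * nat c] (mod N)"
        using h c by (simp flip: cong_int_iff)
      moreover have "int (nat y) \<le> int (nat c * t * N)" using h c by simp
      ultimately show ?thesis using c h unfolding cong_def by linarith
    qed
    show "\<forall>a'\<in>skew_sector N t q.
        (case case a' of (c, y) \<Rightarrow> (nat c, nat y div N) of (c, j) \<Rightarrow> (int c, int (u * c mod N + N * j))) = a'"
    proof
      fix z assume "z \<in> skew_sector N t q"
      moreover obtain c y where z: "z = (c, y)" by force
      ultimately have sk': "0 \<le> c" "0 \<le> y" "nat y mod N = u * nat c mod N"
        using sk[of c y] by auto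
      have "u * nat c mod N + N * (nat y div N) = nat y"
        unfolding sk'(3)[symmetric] by (rule mod_mult_div_eq)
      then show "(case case z of (c, y) \<Rightarrow> (nat c, nat y div N) of (c, j) \<Rightarrow> (int c, int (u * c mod N + N * j))) = z"
        using sk' unfolding z prod.case by (simp only: int_nat_eq if_True)
    qed
    show "(\<lambda>(c, y). (nat c, nat y div N)) ` skew_sector N t q
        \<subseteq> (SIGMA c:UNIV. {..<c * t + (if N dvd c then 1 else 0)})"
    proof (rule image_subsetI)
      fix z assume "z \<in> skew_sector N t q"
      moreover obtain c y where z: "z = (c, y)" by force
      ultimately have "u * nat c mod N + N * (nat y div N) \<le> nat c * t * N"
        using sk[of c y] by (metis mod_mult_div_eq)
      then show "(case z of (c, y) \<Rightarrow> (nat c, nat y div N))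
          \<in> (SIGMA c:UNIV. {..<c * t + (if N dvd c then 1 else 0)})"
        unfolding z len by simp
    qed
    show "(\<lambda>(c, j). (int c, int (u * c mod N + N * j)))
        ` (SIGMA c:UNIV. {..<c * t + (if N dvd c then 1 else 0)}) \<subseteq> skew_sector N t q"
    proof (rule image_subsetI)
      fix z assume "z \<in> (SIGMA c:UNIV. {..<c * t + (if N dvd c then 1 else 0)})"
      then obtain c j where z: "z = (c, j)" and "j < c * t + (if N dvd c then 1 else 0)" by auto
      then have "int (u * c mod N + N * j) \<le> int (c * t * N)" using len by (metis of_nat_mono)
      moreover have "[int (u * c mod N + N * j) = int u * int c] (mod int N)"
        unfolding of_nat_mult[symmetric] cong_int_iff by (simp add: cong_def)
      ultimately show "(case z of (c, j) \<Rightarrow> (int c, int (u * c mod N + N * j))) \<in> skew_sector N t q"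
        unfolding skew_sector_def dvd_iff z by simp
    qed
  qed
qed

text \<open>A step of \<open>N\<close> in height changes the polynomial by \<open>k\<close>, so in
  the parametrisation by \<open>c\<close> and \<open>j\<close> a packing is exactly a
  \<open>stair_tiling\<close>.\<close>

lemma no_skew_packing:
  fixes N t k :: nat and q :: int and A e :: real
  assumes "0 < N" "0 < t" "4 \<le> k" "coprime q (int N)"
    and bij: "bij_betw (\<lambda>(c, y). real t * (real_of_int c)\<^sup>2 / 2 + A * real_of_int c + e
               + real k * real_of_int y / real N) (skew_sector N t q) \<nat>" (is "bij_betw ?F _ _")
  shows False
proof -
  obtain x where x: "[q * x = 1] (mod int N)" using assms(4) cong_solve_coprime_int by blast
  define u where "u = nat ((- x) mod int N)"
  have "[int u = - x] (mod int N)" using \<open>0 < N\<close> by (simp add: u_def cong_def)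
  then have "[int u * q = - x * q] (mod int N)" by (rule cong_scalar_right)
  moreover have "[- (q * x) = - 1] (mod int N)" using x by (simp add: cong_minus_minus_iff)
  ultimately have uq: "[int u * q = - 1] (mod int N)"
    by (simp add: mult.commute cong_trans)
  have cop: "coprime u N" using uq by (rule coprime_if_cong_minus_1)
  define L where "L c = c * t + (if N dvd c then 1 else 0)" for c
  define G where "G = (\<lambda>(c, j). (int c, int (u * c mod N + N * j)))"
  have G: "bij_betw G (SIGMA c:UNIV. {..<L c}) (skew_sector N t q)"
    unfolding L_def G_def by (rule bij_betw_skew_sector) fact+
  have FG: "bij_betw (?F \<circ> G) (SIGMA c:UNIV. {..<L c}) \<nat>"
    by (rule bij_betw_trans[OF G bij])
  \<comment> \<open>The floor only changes the type: the value is a natural number because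
    \<open>(c, 0)\<close> indexes a point of the sector.\<close>
  define f where "f c = nat \<lfloor>?F (G (c, 0))\<rfloor>" for c
  have f: "real (f c) = ?F (G (c, 0))" for c
  proof -
    have "(c, 0) \<in> (SIGMA c:UNIV. {..<L c})" using \<open>0 < t\<close> by (cases "c = 0") (auto simp: L_def)
    then have "(?F \<circ> G) (c, 0) \<in> \<nat>" by (rule bij_betw_apply[OF FG])
    then obtain i where "?F (G (c, 0)) = of_nat i" unfolding o_apply by (rule Nats_cases)
    then show ?thesis unfolding f_def by simp
  qed
  have eq: "(?F \<circ> G) z = real ((\<lambda>(c, j). f c + k * j) z)" for z
    using \<open>0 < N\<close> by (cases z) (simp add: f, simp add: G_def field_simps)
  have "?F \<circ> G = real \<circ> (\<lambda>(c, j). f c + k * j)"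
    by (rule ext) (simp only: eq, simp)
  then have "bij_betw (real \<circ> (\<lambda>(c, j). f c + k * j)) (SIGMA c:UNIV. {..<L c}) \<nat>"
    using FG by (simp only:)
  moreover have "bij_betw real UNIV \<nat>"
    by (simp add: bij_betw_def Nats_def inj_on_def)
  ultimately have "bij_betw (\<lambda>(c, j). f c + k * j) (SIGMA c:UNIV. {..<L c}) UNIV"
    using bij_betw_comp_iff2[OF _ subset_UNIV] by blast
  then interpret stair_tiling f L t N k u A e
    using assms cop by unfold_locales (auto simp: f G_def L_def)
  show False by (rule no_tiling)
qed

text \<open>
  Turning each staircase upside down swaps the sign of the slope along it and replaces \<open>q\<close> by \<open>- q\<close>.
\<close>

lemma no_skew_packing_neg:
  fixes N t k :: nat and q :: int and A e :: real
  assumes "0 < N" "0 < t" "4 \<le> k" "coprime q (int N)"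
    and bij: "bij_betw (\<lambda>(c, y). real t * (real_of_int c)\<^sup>2 / 2 + A * real_of_int c + e
               - real k * real_of_int y / real N) (skew_sector N t q) \<nat>" (is "bij_betw ?F _ _")
  shows False
proof -
  \<comment> \<open>The reflection of each staircase that exchanges heights 0 and
    \<open>c * t * N\<close>; it changes the linear coefficient by \<open>- k * t\<close>.\<close>
  define R where "R = (\<lambda>(c, y). (c, c * int t * int N - y))"
  have RR: "R (R z) = z" for z by (cases z) (simp add: R_def)
  have R: "R z \<in> skew_sector N t (- q')" if "z \<in> skew_sector N t q'" for z q'
  proof -
    obtain c y where z: "z = (c, y)" by force
    have eq: "c + - q' * (c * int t * int N - y) = (c + q' * y) - int N * (q' * c * int t)"
      by (simp add: algebra_simps)
    have "int N dvd c + - q' * (c * int t * int N - y)"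
      using that unfolding eq z skew_sector_def by (intro dvd_diff) auto
    then show ?thesis using that by (simp add: R_def z skew_sector_def)
  qed
  have "bij_betw R (skew_sector N t (- q)) (skew_sector N t q)"
    by (rule bij_betw_byWitness[where f' = R]) (use RR R R[of _ "- q"] in auto)
  then have "bij_betw (?F \<circ> R) (skew_sector N t (- q)) \<nat>" using bij by (rule bij_betw_trans)
  also have "?F \<circ> R = (\<lambda>(c, y). real t * (real_of_int c)\<^sup>2 / 2 + (A - real k * real t) * real_of_int c + e
               + real k * real_of_int y / real N)"
    using \<open>0 < N\<close> by (auto simp: R_def field_simps)
  finally show False by (rule no_skew_packing[rotated 4]) (use assms in auto)
qed

section \<open>The shape of stair polynomials\<close>

lemma quadratic_coeffs:
  assumes "quadratic p"
  obtains a20 a11 a02 a10 a01 a00 where "p = [:[:a00, a10, a20:], [:a01, a11:], [:a02:]:]"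
proof -
  have z: "coeff (coeff p j) i = 0" if "2 < i + j" for i j
    using assms that unfolding quadratic_def bicoeff_def by (meson not_le)
  have "p = [:[:coeff (coeff p 0) 0, coeff (coeff p 0) 1, coeff (coeff p 0) 2:],
      [:coeff (coeff p 1) 0, coeff (coeff p 1) 1:], [:coeff (coeff p 2) 0:]:]"
    by (intro poly_eqI) (auto simp: coeff_pCons z numeral_2_eq_2 split: nat.split)
  then show ?thesis by (rule that)
qed

lemma bieval_homogeneous_part_2:
  "bieval (homogeneous_part 2 p) (x, y)
    = bicoeff p 2 0 * x\<^sup>2 + bicoeff p 1 1 * x * y + bicoeff p 0 2 * y\<^sup>2"
proof -
  have "{..2::nat} = {0, 1, 2}" by auto
  then show ?thesis by (simp add: homogeneous_part_def)
qed

text \<open>Leaving the quadratic part as an evaluated polynomial lets the prescribed one be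
  substituted directly, without comparing coefficients.\<close>

lemma bieval_split:
  assumes "quadratic p"
  obtains a b e where
    "\<And>x y. bieval p (x, y) = bieval (homogeneous_part 2 p) (x, y) + a * x + b * y + e"
proof -
  obtain a20 a11 a02 a10 a01 a00 where p: "p = [:[:a00, a10, a20:], [:a01, a11:], [:a02:]:]"
    by (rule quadratic_coeffs[OF assms])
  have "bieval p (x, y) = bieval (homogeneous_part 2 p) (x, y) + a10 * x + a01 * y + a00" for x y
  proof -
    have "bicoeff p 2 0 = a20" "bicoeff p 1 1 = a11" "bicoeff p 0 2 = a02"
      by (simp_all add: bicoeff_def p numeral_2_eq_2)
    moreover have "bieval p (x, y) = a00 + x * (a10 + x * a20) + y * (a01 + x * a11) + y * y * a02"
      by (simp add: bieval_def p algebra_simps)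
    ultimately show ?thesis
      unfolding bieval_homogeneous_part_2 by (simp add: algebra_simps power2_eq_square)
  qed
  then show ?thesis by (rule that)
qed

lemma k_stair_polynomial_eval:
  assumes "k_stair_polynomial k n m p"
  obtains a b e where
    "\<And>x y. bieval p (x, y) = real n / 2 * (x - (real m - 1) / real n * y)\<^sup>2 + a * x + b * y + e"
proof -
  have "quadratic p" and hom: "homogeneous_part 2 p
      = const2 (real n / 2) * (X2 - const2 ((real m - 1) / real n) * Y2) ^ 2"
    using assms by (auto simp: k_stair_polynomial_def)
  then obtain a b e where
    "\<And>x y. bieval p (x, y) = bieval (homogeneous_part 2 p) (x, y) + a * x + b * y + e"
    using bieval_split by blast
  then show ?thesis by (intro that[of a b e]) (simp add: hom)
qed

section \<open>Stairs and lattice points of the sector\<close>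

text \<open>As \<open>q\<close> and \<open>N\<close> are coprime, \<open>(q, N)\<close> is the
  primitive lattice vector along the staircases. One explicit pair suffices, because the quadratic
  part is constant on a staircase and the linear part changes equally along every such step.\<close>

lemma consecutive_stairs_witness:
  fixes n m N q l :: nat
  assumes "0 < m" and l: "l = gcd n (m - 1)" "0 < l" and n: "n = l * N" and m: "m - 1 = l * q"
    and cop: "coprime q N" and "0 < N"
  shows "consecutive_stairs n m (1, 0) (1 + real q, real N)"
proof -
  have nr: "real n = real l * real N" and mr: "real m = real l * real q + 1"
    using n m \<open>0 < m\<close> by (simp_all flip: of_nat_mult add: m[symmetric])
  have r: "(1, 0) \<in> staircase n m N" and s: "(1 + real q, real N) \<in> staircase n m N"
  proof -
    show "(1, 0) \<in> staircase n m N"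
      by (simp add: staircase_def sector_def del: One_nat_def flip: l(1)) (simp add: nr)
    have "real N * real m \<le> real n * (1 + real q)"
      using \<open>0 < l\<close> mult_right_mono[of 1 "real l" "real N"] by (simp add: nr mr algebra_simps)
    then have "real N \<le> real n / real m * (1 + real q)"
      using \<open>0 < m\<close> by (simp add: field_simps)
    then show "(1 + real q, real N) \<in> staircase n m N"
      by (simp add: staircase_def sector_def del: One_nat_def flip: l(1)) (simp add: nr mr algebra_simps)
  qed
  have ip: "(1, 0) \<in> int_plane" "(1 + real q, real N) \<in> int_plane"
    by (auto simp: int_plane_def)
  have "z = (1, 0) \<or> z = (1 + real q, real N)"
    if z: "z \<in> int_plane" "z \<in> closed_segment (1, 0) (1 + real q, real N)" for z
  proof -
    obtain w where w: "0 \<le> w" "w \<le> 1" "z = (1 + w * real q, w * real N)"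
      using z(2) by (auto simp: in_segment algebra_simps)
    obtain i j where "z = (of_int i, of_int j)"
      using z(1) by (auto simp: int_plane_def elim!: Ints_cases)
    then have ij: "w * real q = of_int (i - 1)" "w * real N = of_int j" using w by auto
    have "real_of_int (j * int q) = real_of_int ((i - 1) * int N)"
      using ij by (metis mult.assoc mult.commute of_int_mult of_int_of_nat_eq)
    \<comment> \<open>Coprimality makes \<open>w = j / N\<close> an integer, so only the two
      endpoints remain.\<close>
    then have "int N dvd j * int q" by (metis dvd_triv_right of_int_eq_iff)
    then have "int N dvd j" using cop by (metis coprime_commute coprime_dvd_mult_left_iff coprime_int_iff)
    then obtain d where "j = int N * d" by blast
    then have "w = of_int d" using ij \<open>0 < N\<close> by simp
    then have "0 \<le> d" "d \<le> 1" using w by simp_all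
    then have "d = 0 \<or> d = 1" by linarith
    then have "w = 0 \<or> w = 1" using \<open>w = of_int d\<close> by auto
    then show ?thesis using w by auto
  qed
  then show ?thesis
    using r s ip \<open>0 < N\<close> unfolding consecutive_stairs_def stairs_def by auto
qed

text \<open>With \<open>n = t * N * N\<close> and \<open>m = t * N * q + 1\<close>, the inequality
  \<open>y * m \<le> n * x\<close> becomes \<open>y \<le> c * t * N\<close> for
  \<open>c = N * x - q * y\<close>. The division is exact on \<open>skew_sector\<close>, and the
  floors only convert integer points to type \<open>int\<close>.\<close>

lemma bij_betw_lattice_sector:
  fixes n m N q l t :: nat
  assumes "0 < m" "0 < l" "0 < N" and n: "n = l * N" and m: "m - 1 = l * q" and lt: "l = t * N"
  shows "bij_betw (\<lambda>(c, y). (real_of_int ((c + int q * y) div int N), real_of_int y))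
    (skew_sector N t (int q)) (lattice_sector (real n / real m))" (is "bij_betw ?G _ _")
proof (rule bij_betw_byWitness[where f' = "\<lambda>(x, y). (int N * \<lfloor>x\<rfloor> - int q * \<lfloor>y\<rfloor>, \<lfloor>y\<rfloor>)"])
  have mem: "(real_of_int x, real_of_int y) \<in> lattice_sector (real n / real m)
      \<longleftrightarrow> (int N * x - int q * y, y) \<in> skew_sector N t (int q)" for x y :: int
  proof -
    have mi: "int m = int l * int q + 1" using m \<open>0 < m\<close> by (simp flip: of_nat_mult add: m[symmetric])
    have "(real_of_int x, real_of_int y) \<in> lattice_sector (real n / real m)
        \<longleftrightarrow> 0 \<le> x \<and> 0 \<le> y \<and> real_of_int y * real m \<le> real n * real_of_int x"
      using \<open>0 < m\<close> by (auto simp: lattice_sector_def sector_def int_plane_def field_simps)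
    also have "real_of_int y * real m \<le> real n * real_of_int x
        \<longleftrightarrow> real_of_int (y * int m) \<le> real_of_int (int n * x)" by simp
    also have "\<dots> \<longleftrightarrow> y * int m \<le> int n * x" by (rule of_int_le_iff)
    also have "\<dots> \<longleftrightarrow> y \<le> (int N * x - int q * y) * int t * int N"
      by (simp add: mi n lt algebra_simps)
    also have "0 \<le> x \<and> 0 \<le> y \<and> \<dots> \<longleftrightarrow> 0 \<le> y \<and> \<dots>"
    proof -
      have "0 \<le> x" if h: "0 \<le> y" "y \<le> (int N * x - int q * y) * int t * int N"
      proof -
        have "0 \<le> (int N * x - int q * y) * int l" using h by (simp add: lt mult.assoc)
        then have "0 \<le> int N * x - int q * y" using \<open>0 < l\<close> by (simp add: zero_le_mult_iff)
        moreover have "0 \<le> int q * y" using h by simp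
        ultimately have "0 \<le> int N * x" by linarith
        then show ?thesis using \<open>0 < N\<close> by (simp add: zero_le_mult_iff)
      qed
      then show ?thesis by blast
    qed
    finally show ?thesis by (simp add: skew_sector_def)
  qed
  have inv: "int N * ((c + int q * y) div int N) - int q * y = c"
    if "(c, y) \<in> skew_sector N t (int q)" for c y
    using that by (simp add: skew_sector_def)
  show "\<forall>a\<in>skew_sector N t (int q).
      (case ?G a of (x, y) \<Rightarrow> (int N * \<lfloor>x\<rfloor> - int q * \<lfloor>y\<rfloor>, \<lfloor>y\<rfloor>)) = a"
    using inv by auto
  have ints: "\<exists>x y. z = (real_of_int x, real_of_int y)" if "z \<in> lattice_sector \<alpha>" for z \<alpha>
    using that by (auto simp: lattice_sector_def int_plane_def elim!: Ints_cases)
  show "\<forall>a'\<in>lattice_sector (real n / real m).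
      ?G (case a' of (x, y) \<Rightarrow> (int N * \<lfloor>x\<rfloor> - int q * \<lfloor>y\<rfloor>, \<lfloor>y\<rfloor>)) = a'"
    using \<open>0 < N\<close> by (auto dest!: ints)
  show "?G ` skew_sector N t (int q) \<subseteq> lattice_sector (real n / real m)"
    using inv by (auto simp: mem)
  show "(\<lambda>(x, y). (int N * \<lfloor>x\<rfloor> - int q * \<lfloor>y\<rfloor>, \<lfloor>y\<rfloor>)) ` lattice_sector (real n / real m)
      \<subseteq> skew_sector N t (int q)"
  proof clarify
    fix x y assume xy: "(x, y) \<in> lattice_sector (real n / real m)"
    then obtain i j where "x = of_int i" "y = of_int j" using ints by blast
    then show "(int N * \<lfloor>x\<rfloor> - int q * \<lfloor>y\<rfloor>, \<lfloor>y\<rfloor>) \<in> skew_sector N t (int q)"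
      using xy mem by simp
  qed
qed

theorem theorem6:
  fixes n m k :: nat
  assumes "0 < n" and "0 < m" and "coprime n m"
    and "n dvd (m - 1)\<^sup>2"
    and "k \<ge> 4"
  shows "\<not> (\<exists>p. k_stair_packing_polynomial k n m p)"
proof
  assume "\<exists>p. k_stair_packing_polynomial k n m p"
  then obtain p where stair: "k_stair_polynomial k n m p"
    and pack: "packing_polynomial (real n / real m) p"
    by (auto simp: k_stair_packing_polynomial_def)
  define l where "l = gcd n (m - 1)"
  have l: "0 < l" using \<open>0 < n\<close> by (simp add: l_def)
  \<comment> \<open>For \<open>m = 1\<close> this yields \<open>N = 1\<close> and
    \<open>q = 0\<close>, so vertical staircases are covered as well.\<close>
  obtain N q where n: "n = N * l" and m: "m - 1 = q * l" and "coprime N q"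
    using gcd_coprime_exists[of n "m - 1"] l unfolding l_def by auto
  have N: "0 < N" using n \<open>0 < n\<close> by (cases N) auto
  \<comment> \<open>Cancelling \<open>l\<close> in \<open>n dvd (m - 1)\<^sup>2\<close> leaves
    \<open>N dvd q\<^sup>2 * l\<close>, and \<open>N\<close> is coprime to \<open>q\<close>.\<close>
  have "l * N dvd l * (q\<^sup>2 * l)"
    using assms(4) unfolding m n by (simp add: power2_eq_square algebra_simps)
  then have "N dvd q\<^sup>2 * l" using l by simp
  then have "N dvd l" using \<open>coprime N q\<close> by (simp add: coprime_dvd_mult_right_iff)
  then obtain t where t: "l = t * N" by (metis dvdE mult.commute)
  have t0: "0 < t" using l t by (cases t) auto
  obtain a b e where ev:
    "\<And>x y. bieval p (x, y) = real n / 2 * (x - (real m - 1) / real n * y)\<^sup>2 + a * x + b * y + e"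
    using k_stair_polynomial_eval[OF stair] by blast
  have nr: "real n = real t * real N * real N" using n t by simp
  have mr: "real m - 1 = real q * real t * real N"
  proof -
    have "real m - 1 = real (m - 1)" using \<open>0 < m\<close> by simp
    also have "\<dots> = real q * real t * real N" unfolding m t by simp
    finally show ?thesis .
  qed
  have ratio: "(real m - 1) / real n = real q / real N" using t0 N by (simp add: nr mr)
  \<comment> \<open>The change of \<open>p\<close> along \<open>(q, N)\<close>, where the quadratic
    part contributes nothing; the stair condition makes it \<open>k\<close> or
    \<open>- k\<close>.\<close>
  define B where "B = a * real q + b * real N"
  have "consecutive_stairs n m (1, 0) (1 + real q, real N)"
    by (rule consecutive_stairs_witness[OF \<open>0 < m\<close> l_def l])
       (use n m \<open>coprime N q\<close> N in \<open>auto simp: mult.commute coprime_commute\<close>)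
  then have "bieval p (1, 0) - bieval p (1 + real q, real N) = real k
      \<or> bieval p (1, 0) - bieval p (1 + real q, real N) = - real k"
    using stair by (auto simp: k_stair_polynomial_def)
  moreover have "bieval p (1, 0) - bieval p (1 + real q, real N) = - B"
    using N unfolding ev ratio B_def by (simp add: algebra_simps)
  ultimately have B: "B = real k \<or> B = - real k" by auto
  define G where "G = (\<lambda>(c, y). (real_of_int ((c + int q * y) div int N), real_of_int y))"
  have "bij_betw G (skew_sector N t (int q)) (lattice_sector (real n / real m))"
    unfolding G_def
    by (rule bij_betw_lattice_sector[OF \<open>0 < m\<close> l N]) (use n m t in \<open>auto simp: mult.commute\<close>)
  then have bijG: "bij_betw (bieval p \<circ> G) (skew_sector N t (int q)) \<nat>"
    using pack unfolding packing_polynomial_def by (rule bij_betw_trans)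
  have eqG: "(bieval p \<circ> G) z = (\<lambda>(c, y). real t * (real_of_int c)\<^sup>2 / 2 + a / real N * real_of_int c + e
      + B * real_of_int y / real N) z" if z: "z \<in> skew_sector N t (int q)" for z
  proof -
    obtain c y where [simp]: "z = (c, y)" by force
    have "real_of_int ((c + int q * y) div int N) = (real_of_int c + real q * real_of_int y) / real N"
      using z by (simp add: skew_sector_def real_of_int_div)
    then show ?thesis using N unfolding G_def B_def
      by (simp add: ev ratio) (simp add: nr field_simps power2_eq_square)
  qed
  have bij: "bij_betw (\<lambda>(c, y). real t * (real_of_int c)\<^sup>2 / 2 + a / real N * real_of_int c + e
      + B * real_of_int y / real N) (skew_sector N t (int q)) \<nat>"
    by (rule bij_betw_cong[THEN iffD1, OF eqG bijG])
  have cop: "coprime (int q) (int N)" using \<open>coprime N q\<close> by (simp add: coprime_commute)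
  from B show False
  proof
    assume "B = real k"
    then show False
      by (intro no_skew_packing[OF N t0 \<open>k \<ge> 4\<close> cop, of "a / real N" e]) (use bij in simp)
  next
    assume "B = - real k"
    then show False
      by (intro no_skew_packing_neg[OF N t0 \<open>k \<ge> 4\<close> cop, of "a / real N" e]) (use bij in simp)
  qed
qed

end
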